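(* Let $I$ be a countable instance over a signature all of whose predicates have arity at most $2$. If $I$ has finite treewidth, then $I$ has finite cliquewidth.
   Context: An instance is a countable set of atoms whose terms are constants or nulls (finitely many constants). A tree decomposition of $I$ is a (possibly infinite) tree $T$ whose nodes are labelled by sets (bags) of terms of $I$ such that every term lies in some bag, the terms of every atom lie together in some bag, and for each term the nodes whose bags contain it form a connected subtree; its width is the supremum of bag sizes minus one, and the treewidth of $I$ is the minimal width of a tree decomposition ($\infty$ if no finite-width one exists). Cliquewidth: for a finite color set $\mathbb{L}$ and finite constant set $\mathrm{Cnst}$, a well-decorated tree labels each node $s\in\{0,1\}^*$ of the infinite binary tree by exactly one of $c_k$ ($c\in\mathrm{Cnst}\cup\{*\}$, $k\in\mathbb{L}$), $\mathrm{Add}_{R,\vec k}$ ($\vec k\in\mathbb{L}^{\mathrm{ar}(R)}$), $\mathrm{Recolor}_{k\to k'}$, $\oplus$, $\mathrm{Void}$, with: each constant decorated at most once; $\mathrm{Add}$/$\mathrm{Recolor}$ nodes have non-$\mathrm{Void}$ left child and $\mathrm{Void}$ right child; $\oplus$ nodes have two non-$\mathrm{Void}$ children; $\mathrm{Void}$ and $c_k$ nodes have $\mathrm{Void}$ children. Node $s$ represents the elements introduced in its subtree (a node decorated $*_k$ introduces itself as a null, $c_k$ introduces constant $c$), each colored with its introduction color modified by the $\mathrm{Recolor}_{k\to k'}$ nodes (recolor every $k$-colored element to $k'$) on the path up to $s$; $\oplus$ takes the disjoint union of the two children; an $\mathrm{Add}_{R,\vec k}$ node adds $R(\vec e)$ for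 all tuples $\vec e$ of its elements with colors $\vec k$. The represented instance is the set of all added atoms (plus $\top$-atoms for all elements), colored by the root. $\mathrm{cw}(I)$ is the least $|\mathbb{L}|$ such that some coloring of $I$ is isomorphic to a colored instance represented by a well-decorated tree, and $\infty$ if none exists.
   Formalization: The signature is taken to be finite (and to contain the unary predicate ⊤); with infinitely many binary predicates all holding of one pair of terms, the treewidth is 1 but no well-decorated tree represents the instance. *)

theory Defs
  imports "HOL-Library.Countable_Set" "HOL-Library.Extended_Nat"
begin

section \<open>Signatures and instances\<close>

text \<open>Signatures are finite and contain the universal unary predicate \<open>top_pred\<close>.\<close>

record 'p sgn =
  preds :: "'p set"
  arity :: "'p \<Rightarrow> nat"
  top_pred :: 'p

definition signature :: "'p sgn \<Rightarrow> bool" where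
  "signature S \<longleftrightarrow> finite (preds S) \<and> top_pred S \<in> preds S \<and> arity S (top_pred S) = 1"

definition binary_signature :: "'p sgn \<Rightarrow> bool" where
  "binary_signature S \<longleftrightarrow> (\<forall>R\<in>preds S. arity S R \<le> 2)"

datatype ('c, 'n) trm = Const 'c | Null 'n

datatype ('p, 'c, 'n) atom = Atom (pred: 'p) (args: "('c, 'n) trm list")

definition terms :: "('p, 'c, 'n) atom set \<Rightarrow> ('c, 'n) trm set" where
  "terms I = (\<Union>a\<in>I. set (args a))"

definition is_instance :: "'p sgn \<Rightarrow> ('p, 'c, 'n) atom set \<Rightarrow> bool" where
  "is_instance S I \<longleftrightarrow>
     countable I \<and>
     (\<forall>a\<in>I. pred a \<in> preds S \<and> length (args a) = arity S (pred a)) \<and>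
     finite {c. Const c \<in> terms I}"

text \<open>
  The predicate \<open>top_pred\<close> holds of every term of an instance. Instances are not required to list
  these atoms; they are added before comparing with the instance represented by a decorated tree.
\<close>

definition top_atoms :: "'p sgn \<Rightarrow> ('c, 'n) trm set \<Rightarrow> ('p, 'c, 'n) atom set" where
  "top_atoms S D = {Atom (top_pred S) [t] | t. t \<in> D}"

definition top_completion :: "'p sgn \<Rightarrow> ('p, 'c, 'n) atom set \<Rightarrow> ('p, 'c, 'n) atom set" where
  "top_completion S I = I \<union> top_atoms S (terms I)"


section \<open>Treewidth\<close>

definition connected_in :: "'v rel \<Rightarrow> 'v set \<Rightarrow> bool" where
  "connected_in E A \<longleftrightarrow> (\<forall>x\<in>A. \<forall>y\<in>A. (x, y) \<in> (E \<inter> A \<times> A)\<^sup>*)"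

definition is_cycle :: "'v rel \<Rightarrow> 'v list \<Rightarrow> bool" where
  "is_cycle E xs \<longleftrightarrow> 3 \<le> length xs \<and> distinct xs \<and>
     successively (\<lambda>x y. (x, y) \<in> E) xs \<and> (last xs, hd xs) \<in> E"

text \<open>A possibly infinite undirected tree, given by its node set and symmetric edge relation.\<close>

definition is_tree :: "'v set \<Rightarrow> 'v rel \<Rightarrow> bool" where
  "is_tree V E \<longleftrightarrow> V \<noteq> {} \<and> E \<subseteq> V \<times> V \<and> sym E \<and> irrefl E \<and>
     connected_in E V \<and> (\<nexists>xs. is_cycle E xs)"

definition tree_decomposition ::
    "('p, 'c, 'n) atom set \<Rightarrow> 'v set \<Rightarrow> 'v rel \<Rightarrow> ('v \<Rightarrow> ('c, 'n) trm set) \<Rightarrow> bool" where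
  "tree_decomposition I V E bag \<longleftrightarrow>
     is_tree V E \<and>
     (\<forall>v\<in>V. bag v \<subseteq> terms I) \<and>
     (\<forall>t\<in>terms I. \<exists>v\<in>V. t \<in> bag v) \<and>
     (\<forall>a\<in>I. \<exists>v\<in>V. set (args a) \<subseteq> bag v) \<and>
     (\<forall>t\<in>terms I. connected_in E {v\<in>V. t \<in> bag v})"

definition ecard :: "'a set \<Rightarrow> enat" where
  "ecard A = (if finite A then enat (card A) else \<infinity>)"

text \<open>
  Subtraction on \<^typ>\<open>enat\<close> is truncated, so a decomposition all of whose bags are empty has
  width \<open>0\<close> rather than \<open>-1\<close>; this concerns only instances without terms.
\<close>

definition width :: "'v set \<Rightarrow> ('v \<Rightarrow> 'a set) \<Rightarrow> enat" where
  "width V bag = (SUP v\<in>V. ecard (bag v)) - 1"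

text \<open>
  A definition cannot range over all types of tree nodes, so the node type is a parameter. A
  statement in which it is a free type variable covers decompositions over trees of any cardinality.
  On a countable instance every infinite node type yields the usual value, because a decomposition
  can be restricted to a countable subtree.
\<close>

definition treewidth :: "'v itself \<Rightarrow> ('p, 'c, 'n) atom set \<Rightarrow> enat" where
  "treewidth TYPE('v) I =
     Inf {width V bag | (V :: 'v set) E bag. tree_decomposition I V E bag}"


section \<open>Well-decorated trees\<close>

text \<open>
  Nodes of the infinite binary tree are words over \<open>{0,1}\<close>, with \<^const>\<open>False\<close> for 0 (left) and
  \<^const>\<open>True\<close> for 1 (right). Colors are natural numbers; this loses nothing, as only the number of
  colors matters. In \<open>Intro c k\<close>, \<open>c = None\<close> stands for \<open>*\<close>, the introduction of a null.
\<close>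

type_synonym node = "bool list"

datatype ('p, 'c) dec =
    Intro "'c option" nat
  | Add 'p "nat list"
  | Recolor nat nat
  | Plus
  | Void

fun admissible :: "'p sgn \<Rightarrow> nat set \<Rightarrow> 'c set \<Rightarrow> ('p, 'c) dec \<Rightarrow> bool" where
  "admissible S L Cnst (Intro None k) \<longleftrightarrow> k \<in> L"
| "admissible S L Cnst (Intro (Some c) k) \<longleftrightarrow> c \<in> Cnst \<and> k \<in> L"
| "admissible S L Cnst (Add R ks) \<longleftrightarrow> R \<in> preds S \<and> length ks = arity S R \<and> set ks \<subseteq> L"
| "admissible S L Cnst (Recolor k k') \<longleftrightarrow> k \<in> L \<and> k' \<in> L"
| "admissible S L Cnst Plus \<longleftrightarrow> True"
| "admissible S L Cnst Void \<longleftrightarrow> True"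

fun children_ok :: "('p, 'c) dec \<Rightarrow> ('p, 'c) dec \<Rightarrow> ('p, 'c) dec \<Rightarrow> bool" where
  "children_ok (Intro c k) l r \<longleftrightarrow> l = Void \<and> r = Void"
| "children_ok (Add R ks) l r \<longleftrightarrow> l \<noteq> Void \<and> r = Void"
| "children_ok (Recolor k k') l r \<longleftrightarrow> l \<noteq> Void \<and> r = Void"
| "children_ok Plus l r \<longleftrightarrow> l \<noteq> Void \<and> r \<noteq> Void"
| "children_ok Void l r \<longleftrightarrow> l = Void \<and> r = Void"

definition well_decorated ::
    "'p sgn \<Rightarrow> nat set \<Rightarrow> 'c set \<Rightarrow> (node \<Rightarrow> ('p, 'c) dec) \<Rightarrow> bool" where
  "well_decorated S L Cnst T \<longleftrightarrow>
     (\<forall>s. admissible S L Cnst (T s)) \<and>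
     (\<forall>s. children_ok (T s) (T (s @ [False])) (T (s @ [True]))) \<and>
     (\<forall>s s' c k k'. T s = Intro (Some c) k \<and> T s' = Intro (Some c) k' \<longrightarrow> s = s')"


section \<open>The represented colored instance\<close>

inductive introduces ::
    "(node \<Rightarrow> ('p, 'c) dec) \<Rightarrow> node \<Rightarrow> ('c, node) trm \<Rightarrow> nat \<Rightarrow> bool" for T where
  "T s = Intro None k \<Longrightarrow> introduces T s (Null s) k"
| "T s = Intro (Some c) k \<Longrightarrow> introduces T s (Const c) k"

fun recolor :: "('p, 'c) dec \<Rightarrow> nat \<Rightarrow> nat" where
  "recolor (Recolor k k') j = (if j = k then k' else j)"
| "recolor _ j = j"

text \<open>
  \<open>path_color T s u k\<close> is the color at node \<open>s\<close> of an element introduced with color \<open>k\<close> at the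
  descendant \<open>s @ u\<close>; the recoloring nodes take effect from the bottom up.
\<close>

primrec path_color :: "(node \<Rightarrow> ('p, 'c) dec) \<Rightarrow> node \<Rightarrow> node \<Rightarrow> nat \<Rightarrow> nat" where
  "path_color T s [] k = k"
| "path_color T s (b # u) k = recolor (T s) (path_color T (s @ [b]) u k)"

definition has_color ::
    "(node \<Rightarrow> ('p, 'c) dec) \<Rightarrow> node \<Rightarrow> ('c, node) trm \<Rightarrow> nat \<Rightarrow> bool" where
  "has_color T s e j \<longleftrightarrow> (\<exists>u k. introduces T (s @ u) e k \<and> j = path_color T s u k)"

definition elements :: "(node \<Rightarrow> ('p, 'c) dec) \<Rightarrow> node \<Rightarrow> ('c, node) trm set" where
  "elements T s = {e. \<exists>u k. introduces T (s @ u) e k}"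

lemma has_color_unique:
  assumes "well_decorated S L Cnst T" "has_color T s e j" "has_color T s e j'"
  shows "j = j'"
proof -
  obtain u k where u: "introduces T (s @ u) e k" "j = path_color T s u k"
    using assms(2) unfolding has_color_def by blast
  obtain u' k' where u': "introduces T (s @ u') e k'" "j' = path_color T s u' k'"
    using assms(3) unfolding has_color_def by blast
  have "s @ u = s @ u' \<and> k = k'"
    using u(1) u'(1) assms(1) unfolding well_decorated_def
    by (elim introduces.cases) (fastforce)+
  then show ?thesis
    using u(2) u'(2) by simp
qed

text \<open>Well defined on the elements of \<open>s\<close> by the preceding lemma.\<close>

definition color :: "(node \<Rightarrow> ('p, 'c) dec) \<Rightarrow> node \<Rightarrow> ('c, node) trm \<Rightarrow> nat" where
  "color T s e = (THE j. has_color T s e j)"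

lemma has_color_iff_color:
  assumes "well_decorated S L Cnst T"
  shows "has_color T s e j \<longleftrightarrow> e \<in> elements T s \<and> color T s e = j"
proof
  assume h: "has_color T s e j"
  then have "e \<in> elements T s"
    unfolding has_color_def elements_def by blast
  moreover have "color T s e = j"
    unfolding color_def using h has_color_unique[OF assms] by blast
  ultimately show "e \<in> elements T s \<and> color T s e = j" ..
next
  assume e: "e \<in> elements T s \<and> color T s e = j"
  then obtain j' where j': "has_color T s e j'"
    unfolding has_color_def elements_def by blast
  then have "color T s e = j'"
    unfolding color_def using has_color_unique[OF assms] by blast
  with e j' show "has_color T s e j" by simp
qed

definition added_atoms :: "(node \<Rightarrow> ('p, 'c) dec) \<Rightarrow> ('p, 'c, node) atom set" where
  "added_atoms T = {Atom R es | R es s ks. T s = Add R ks \<and> length es = length ks \<and>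
     (\<forall>i<length ks. es ! i \<in> elements T s \<and> color T s (es ! i) = ks ! i)}"

definition represented :: "'p sgn \<Rightarrow> (node \<Rightarrow> ('p, 'c) dec) \<Rightarrow> ('p, 'c, node) atom set" where
  "represented S T = added_atoms T \<union> top_atoms S (elements T [])"


section \<open>Cliquewidth\<close>

fun map_atom_terms ::
    "(('c, 'n) trm \<Rightarrow> ('c, 'm) trm) \<Rightarrow> ('p, 'c, 'n) atom \<Rightarrow> ('p, 'c, 'm) atom" where
  "map_atom_terms h (Atom R ts) = Atom R (map h ts)"

text \<open>
  Isomorphisms fix constants in both directions, so in particular they map nulls to nulls.
\<close>

definition colored_isomorphism ::
    "(('c, 'n) trm \<Rightarrow> ('c, 'm) trm) \<Rightarrow>
     ('p, 'c, 'n) atom set \<times> (('c, 'n) trm \<Rightarrow> nat) \<Rightarrow>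
     ('p, 'c, 'm) atom set \<times> (('c, 'm) trm \<Rightarrow> nat) \<Rightarrow> bool" where
  "colored_isomorphism h = (\<lambda>(I, col) (J, col').
     bij_betw h (terms I) (terms J) \<and>
     (\<forall>t\<in>terms I. \<forall>c. t = Const c \<longleftrightarrow> h t = Const c) \<and>
     map_atom_terms h ` I = J \<and>
     (\<forall>t\<in>terms I. col' (h t) = col t))"

definition cliquewidth :: "'p sgn \<Rightarrow> ('p, 'c, 'n) atom set \<Rightarrow> enat" where
  "cliquewidth S I = Inf {enat (card L) | L :: nat set. finite L \<and>
     (\<exists>Cnst T col h. finite Cnst \<and> well_decorated S L Cnst T \<and> col ` terms I \<subseteq> L \<and>
        colored_isomorphism h (top_completion S I, col) (represented S T, color T []))}"

end

theory Submission
  imports Defs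
begin

text \<open>
  Root the tree of a decomposition with bags of size at most \<open>k\<close>, and let \<open>y < u\<close> if the topmost
  bag of \<open>y\<close> lies above that of \<open>u\<close> (ties inside a bag are broken arbitrarily). This is a forest
  order in which adjacent terms are comparable, and the terms \<open>y < u\<close> that are adjacent to some
  \<open>x \<ge> u\<close> lie in the topmost bag of \<open>u\<close>. Hence terms can be given slots from \<open>{0..k}\<close> such that
  \<open>u\<close> always differs in its slot from these \<open>y\<close>. The decorated tree follows the forest downwards. At
  \<open>u\<close> the color of \<open>x \<ge> u\<close> records which atoms link \<open>x\<close> to which slots among the terms up to
  \<open>u\<close>. These finitely many colors suffice to add the atoms joining \<open>u\<close> to terms above it; afterwards
  the slot of \<open>u\<close> is erased from all colors.
\<close>

section \<open>Rooted trees\<close>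

lemma rtrancl_imp_distinct_path:
  assumes "(x, y) \<in> R\<^sup>*"
  shows "\<exists>xs. xs \<noteq> [] \<and> hd xs = x \<and> last xs = y \<and> distinct xs \<and>
    successively (\<lambda>a b. (a, b) \<in> R) xs"
  using assms
proof (induction rule: converse_rtrancl_induct)
  case base
  show ?case by (rule exI[of _ "[y]"]) simp
next
  case (step x z)
  then obtain zs where zs: "zs \<noteq> []" "hd zs = z" "last zs = y" "distinct zs"
    "successively (\<lambda>a b. (a, b) \<in> R) zs" by blast
  show ?case
  proof (cases "x \<in> set zs")
    case True
    then obtain as bs where "zs = as @ x # bs" by (meson split_list)
    with zs show ?thesis
      by (intro exI[of _ "x # bs"]) (auto simp: successively_append_iff)
  next
    case False
    with zs step(1) show ?thesis
      by (intro exI[of _ "x # zs"]) (auto simp: successively_Cons)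
  qed
qed

text \<open>A simple path from \<open>x\<close> to \<open>y\<close> that avoids the edge has at
  least three vertices, so the edge would close it to a cycle.\<close>

lemma acyclic_edge_is_bridge:
  assumes "sym E" "irrefl E" "\<nexists>xs. is_cycle E xs" "(x, y) \<in> E"
  shows "(x, y) \<notin> (E - {(x, y), (y, x)})\<^sup>*"
proof
  assume "(x, y) \<in> (E - {(x, y), (y, x)})\<^sup>*"
  then obtain xs where xs: "xs \<noteq> []" "hd xs = x" "last xs = y" "distinct xs"
    "successively (\<lambda>a b. (a, b) \<in> E - {(x, y), (y, x)}) xs"
    using rtrancl_imp_distinct_path by metis
  have "x \<noteq> y" using assms(2,4) by (auto simp: irrefl_def)
  then obtain b xs' where xs': "xs = x # b # xs'"
    using xs(1-3) by (metis last_ConsL list.sel(1) neq_Nil_conv)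
  then have "xs' \<noteq> []" using xs by auto
  then have "3 \<le> length xs" using xs' by (cases xs') auto
  moreover have "successively (\<lambda>a b. (a, b) \<in> E) xs"
    using xs(5) by (rule successively_mono) auto
  moreover have "(last xs, hd xs) \<in> E" using xs assms(1,4) by (auto dest: symD)
  ultimately have "is_cycle E xs" using xs(4) by (simp add: is_cycle_def)
  with assms(3) show False by blast
qed

text \<open>The root is a fixed point of \<open>par\<close>, so iterates of \<open>par\<close> are
  total and their values at \<open>v\<close> are the ancestors of \<open>v\<close>.\<close>

locale rooted_tree =
  fixes V :: "'v set" and E :: "'v rel" and r :: 'v and par :: "'v \<Rightarrow> 'v" and dep :: "'v \<Rightarrow> nat"
  assumes par_root: "par r = r"
    and par_in: "v \<in> V \<Longrightarrow> par v \<in> V"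
    and dep_par: "v \<in> V \<Longrightarrow> v \<noteq> r \<Longrightarrow> dep (par v) < dep v"
    and edge_par: "(x, y) \<in> E \<Longrightarrow> par x = y \<or> par y = x"

text \<open>Depth is the distance from \<open>r\<close>. By acyclicity the parent is the only
  neighbor that is not deeper than the vertex itself.\<close>

lemma is_tree_imp_rooted_tree:
  assumes "is_tree V E" "r \<in> V"
  shows "\<exists>par dep. rooted_tree V E r par dep"
proof -
  have E: "E \<subseteq> V \<times> V" "sym E" "irrefl E" "\<nexists>xs. is_cycle E xs" "connected_in E V"
    using assms(1) unfolding is_tree_def by auto
  have EV: "E \<inter> V \<times> V = E" using E(1) by auto
  define dep where "dep v = (LEAST n. (r, v) \<in> E ^^ n)" for v
  have reach: "(r, v) \<in> E ^^ dep v" if "v \<in> V" for v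
  proof -
    have "(r, v) \<in> E\<^sup>*" using E(5) that assms(2) unfolding connected_in_def EV by blast
    then obtain n where "(r, v) \<in> E ^^ n" using rtrancl_imp_relpow by blast
    then show ?thesis unfolding dep_def by (rule LeastI)
  qed
  have pred: "\<exists>p. (p, v) \<in> E \<and> dep p < dep v" if v: "v \<in> V" "v \<noteq> r" for v
  proof -
    obtain n where n: "dep v = Suc n"
      using reach[OF v(1)] v(2) by (cases "dep v") auto
    then obtain p where p: "(r, p) \<in> E ^^ n" "(p, v) \<in> E"
      using reach[OF v(1)] by auto
    then have "dep p \<le> n" unfolding dep_def by (intro Least_le)
    with p n show ?thesis by auto
  qed
  define par where "par v = (if v = r then r else SOME p. (p, v) \<in> E \<and> dep p < dep v)" for v
  have par: "(par v, v) \<in> E" "dep (par v) < dep v" if "v \<in> V" "v \<noteq> r" for v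
    using someI_ex[OF pred[OF that]] that by (auto simp: par_def)
  \<comment> \<open>The path of parents from \<open>w\<close> to the root misses \<open>v\<close>,
    since after its first vertex all depths lie below \<open>dep v\<close>.\<close>
  have avoid: "(r, w) \<in> (E - {(a, b). a = v \<or> b = v})\<^sup>*"
    if "w \<in> V" "w \<noteq> v" "dep w \<le> dep v" for v w
    using that
  proof (induction "dep w" arbitrary: w rule: less_induct)
    case less
    show ?case
    proof (cases "w = r")
      case False
      then have p: "(par w, w) \<in> E" "dep (par w) < dep w" using par less.prems by auto
      then have "par w \<in> V" "par w \<noteq> v" using E(1) less.prems by auto
      then have "(r, par w) \<in> (E - {(a, b). a = v \<or> b = v})\<^sup>*"
        using less.hyps[OF p(2)] less.prems p(2) by auto
      moreover have "(par w, w) \<in> E - {(a, b). a = v \<or> b = v}"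
        using p(1) \<open>par w \<noteq> v\<close> less.prems by auto
      ultimately show ?thesis by (rule rtrancl_into_rtrancl)
    qed simp
  qed
  \<comment> \<open>Otherwise \<open>p\<close> and \<open>q\<close> are joined through the root
    without using \<open>v\<close>, and the edge from \<open>q\<close> to \<open>v\<close> completes
    a bypass of the bridge between \<open>p\<close> and \<open>v\<close>.\<close>
  have uniq: "p = q" if "(p, v) \<in> E" "(q, v) \<in> E" "dep p \<le> dep v" "dep q \<le> dep v" for p q v
  proof (rule ccontr)
    assume "p \<noteq> q"
    let ?A = "E - {(a, b). a = v \<or> b = v}" and ?F = "E - {(p, v), (v, p)}"
    have ne: "p \<noteq> v" "q \<noteq> v" using that E(3) by (auto simp: irrefl_def)
    have "sym ?A" using E(2) by (auto simp: sym_def)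
    then have "(p, r) \<in> ?A\<^sup>*" "(r, q) \<in> ?A\<^sup>*"
      using avoid[of p v] avoid[of q v] that ne E(1) by (auto intro: symD[OF sym_rtrancl])
    moreover have "?A\<^sup>* \<subseteq> ?F\<^sup>*" by (rule rtrancl_mono) auto
    ultimately have "(p, q) \<in> ?F\<^sup>*" by (meson rtrancl_trans subsetD)
    moreover have "(q, v) \<in> ?F" using that(2) \<open>p \<noteq> q\<close> ne by auto
    ultimately have "(p, v) \<in> ?F\<^sup>*" by (rule rtrancl_into_rtrancl)
    then show False using acyclic_edge_is_bridge[OF E(2-4) that(1)] by blast
  qed
  have up: "par y = x" if "(x, y) \<in> E" "dep x \<le> dep y" for x y
  proof -
    have xy: "x \<in> V" "y \<in> V" "x \<noteq> y" using that(1) E(1,3) by (auto simp: irrefl_def)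
    have "dep r = 0" unfolding dep_def by (rule Least_eq_0) simp
    then have "y \<noteq> r" using that(2) reach[OF xy(1)] xy(3) by (intro notI) simp
    then show ?thesis using uniq[of "par y" y x] par[of y] xy that by auto
  qed
  have "rooted_tree V E r par dep"
  proof
    show "par r = r" by (simp add: par_def)
    show "par v \<in> V" if "v \<in> V" for v
      using par(1)[OF that] E(1) assms(2) that by (cases "v = r") (auto simp: par_def)
    show "dep (par v) < dep v" if "v \<in> V" "v \<noteq> r" for v using par that by blast
    show "par x = y \<or> par y = x" if "(x, y) \<in> E" for x y
      using up[OF that] up[of y x] that E(2) by (cases "dep x \<le> dep y") (auto dest: symD)
  qed
  then show ?thesis by blast
qed

section \<open>Ancestors and topmost nodes\<close>

context rooted_tree
begin

definition anc :: "'v \<Rightarrow> 'v \<Rightarrow> bool" where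
  "anc a v \<longleftrightarrow> (\<exists>n. (par ^^ n) v = a)"

lemma funpow_par_in: "v \<in> V \<Longrightarrow> (par ^^ n) v \<in> V"
  by (induction n) (auto intro: par_in)

lemma anc_in: "anc a v \<Longrightarrow> v \<in> V \<Longrightarrow> a \<in> V"
  using funpow_par_in unfolding anc_def by blast

lemma anc_refl [simp]: "anc a a"
  unfolding anc_def by (rule exI[of _ 0]) simp

lemma anc_trans: "anc a b \<Longrightarrow> anc b c \<Longrightarrow> anc a c"
  unfolding anc_def by (metis comp_apply funpow_add)

lemma anc_linear:
  assumes "anc a v" "anc b v"
  shows "anc a b \<or> anc b a"
proof -
  obtain n m where nm: "(par ^^ n) v = a" "(par ^^ m) v = b"
    using assms unfolding anc_def by blast
  show ?thesis
  proof (cases "n \<le> m")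
    case True
    then have "(par ^^ (m - n)) a = b" using nm by (metis comp_apply funpow_add le_add_diff_inverse2)
    then show ?thesis unfolding anc_def by blast
  next
    case False
    then have "(par ^^ (n - m)) b = a"
      using nm by (metis comp_apply funpow_add le_add_diff_inverse2 nat_le_linear)
    then show ?thesis unfolding anc_def by blast
  qed
qed

text \<open>The first alternative covers \<open>n = 0\<close> and the root.\<close>

lemma dep_funpow:
  "v \<in> V \<Longrightarrow> (par ^^ n) v = v \<or> dep ((par ^^ n) v) < dep v"
proof (induction n)
  case (Suc n)
  then have "par ((par ^^ n) v) = (par ^^ n) v \<or> dep (par ((par ^^ n) v)) < dep ((par ^^ n) v)"
    using dep_par[OF funpow_par_in[OF Suc.prems]] par_root by metis
  then show ?case using Suc by fastforce
qed simp

lemma anc_antisym: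
  assumes "anc a b" "anc b a" "a \<in> V"
  shows "a = b"
proof -
  have "b \<in> V" using anc_in assms by blast
  then show ?thesis
    using assms dep_funpow[of a] dep_funpow[of b] unfolding anc_def by (metis less_asym)
qed

lemma finite_anc: "v \<in> V \<Longrightarrow> finite {a. anc a v}"
proof (induction "dep v" arbitrary: v rule: less_induct)
  case less
  have step: "{a. anc a v} \<subseteq> insert v {a. anc a (par v)}"
  proof
    fix a assume "a \<in> {a. anc a v}"
    then obtain n where n: "(par ^^ n) v = a" unfolding anc_def by blast
    then show "a \<in> insert v {a. anc a (par v)}"
      by (cases n) (auto simp: anc_def funpow_swap1)
  qed
  show ?case
  proof (cases "v = r")
    case True
    have "(par ^^ n) r = r" for n by (induction n) (auto simp: par_root)
    then have "{a. anc a v} = {r}" using True by (auto simp: anc_def)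
    then show ?thesis by simp
  next
    case False
    then show ?thesis
      using less dep_par par_in step by (meson finite_insert finite_subset)
  qed
qed

text \<open>The top is a vertex \<open>a\<close> of least depth. Along a walk in \<open>A\<close>
  starting at \<open>a\<close>, a step to a child prolongs the upward path back to \<open>a\<close>
  and a step to a parent shortens it, so this path stays in \<open>A\<close>.\<close>

lemma connected_has_top:
  assumes "connected_in E A" "A \<noteq> {}" "A \<subseteq> V"
  shows "\<exists>a\<in>A. \<forall>w\<in>A. \<exists>n. (par ^^ n) w = a \<and> (\<forall>m\<le>n. (par ^^ m) w \<in> A)"
proof -
  obtain a where a: "a \<in> A" "\<And>w. w \<in> A \<Longrightarrow> dep a \<le> dep w"
    using ex_has_least_nat[of "\<lambda>a. a \<in> A" _ dep] assms(2) by blast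
  have "\<exists>n. (par ^^ n) w = a \<and> (\<forall>m\<le>n. (par ^^ m) w \<in> A)" if "w \<in> A" for w
  proof -
    have "(a, w) \<in> (E \<inter> A \<times> A)\<^sup>*" using assms(1) a(1) that unfolding connected_in_def by blast
    then show ?thesis
    proof induction
      case base
      show ?case by (rule exI[of _ 0]) (use a in simp)
    next
      case (step y z)
      then obtain n where n: "(par ^^ n) y = a" "\<forall>m\<le>n. (par ^^ m) y \<in> A" by blast
      have yz: "(y, z) \<in> E" "y \<in> A" "z \<in> A" using step by auto
      consider "par z = y" | "par y = z" using edge_par yz by blast
      then show ?case
      proof cases
        case 1
        have "(par ^^ m) z \<in> A" if "m \<le> Suc n" for m
          using that n(2) yz(3) 1 by (cases m) (auto simp: funpow_swap1)
        moreover have "(par ^^ Suc n) z = a" using n(1) 1 by (simp add: funpow_swap1)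
        ultimately show ?thesis by blast
      next
        case 2
        show ?thesis
        proof (cases n)
          case 0
          then have "y = a" using n by simp
          \<comment> \<open>A proper step up from \<open>a\<close> would undercut the least depth,
            so \<open>a\<close> is the root, which \<open>par\<close> fixes.\<close>
          then have "z = a" using 2 a(2)[OF yz(3)] dep_par[of a] a(1) assms(3) par_root
            by (metis leD subsetD)
          then show ?thesis using a(1) by (intro exI[of _ 0]) simp
        next
          case (Suc n')
          have "(par ^^ m) z = (par ^^ Suc m) y" for m using 2 by (simp add: funpow_swap1)
          then show ?thesis using n Suc by (intro exI[of _ n']) (metis Suc_le_mono)
        qed
      qed
    qed
  qed
  with a(1) show ?thesis by blast
qed

end


section \<open>Elimination orders\<close>

text \<open>The edges of the Gaifman graph, together with a loop at every term.\<close>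

definition adjacent :: "('p, 'c, 'n) atom set \<Rightarrow> ('c, 'n) trm \<Rightarrow> ('c, 'n) trm \<Rightarrow> bool" where
  "adjacent I x y \<longleftrightarrow> (\<exists>a\<in>I. x \<in> set (args a) \<and> y \<in> set (args a))"

text \<open>A possibly infinite elimination forest of the Gaifman graph: smaller terms are nearer to
  the roots.\<close>

locale elimination_order =
  fixes I :: "('p, 'c, 'n) atom set" and lt :: "('c, 'n) trm \<Rightarrow> ('c, 'n) trm \<Rightarrow> bool"
  assumes lt_irrefl: "\<not> lt x x"
    and lt_trans: "lt x y \<Longrightarrow> lt y z \<Longrightarrow> lt x z"
    and finite_below: "u \<in> terms I \<Longrightarrow> finite {y \<in> terms I. lt y u}"
    and lt_linear: "y \<in> terms I \<Longrightarrow> z \<in> terms I \<Longrightarrow> u \<in> terms I \<Longrightarrow>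
      lt y u \<Longrightarrow> lt z u \<Longrightarrow> y = z \<or> lt y z \<or> lt z y"
    and lt_adjacent: "adjacent I x y \<Longrightarrow> x = y \<or> lt x y \<or> lt y x"
begin

definition below :: "('c, 'n) trm \<Rightarrow> ('c, 'n) trm set" where
  "below u = {y \<in> terms I. lt y u}"

definition above :: "('c, 'n) trm \<Rightarrow> ('c, 'n) trm set" where
  "above u = {x \<in> terms I. x = u \<or> lt u x}"

text \<open>In the Gaifman graph these are the only neighbors of the subtree \<open>above u\<close>
  (which contains \<open>u\<close>) outside it. Their number takes over the role of the bag
  size.\<close>

definition separator :: "('c, 'n) trm \<Rightarrow> ('c, 'n) trm set" where
  "separator u = {y \<in> below u. \<exists>x\<in>above u. adjacent I x y}"

end

section \<open>From tree decompositions to elimination orders\<close>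

lemma tree_decomposition_imp_elimination_order:
  fixes I :: "('p, 'c, 'n) atom set"
  assumes td: "tree_decomposition I V E bag"
    and bags: "\<And>v. v \<in> V \<Longrightarrow> finite (bag v) \<and> card (bag v) \<le> k"
    and inj: "inj_on (code :: _ \<Rightarrow> nat) (terms I)"
  shows "\<exists>lt. elimination_order I lt \<and>
    (\<forall>u\<in>terms I. card (elimination_order.separator I lt u) \<le> k)"
proof -
  have tree: "is_tree V E" using td unfolding tree_decomposition_def by blast
  then obtain r where "r \<in> V" unfolding is_tree_def by blast
  then obtain par dep where "rooted_tree V E r par dep"
    using is_tree_imp_rooted_tree[OF tree] by blast
  then interpret rooted_tree V E r par dep .
  have "\<exists>a. a \<in> V \<and> t \<in> bag a \<and> (\<forall>w\<in>V. t \<in> bag w \<longrightarrow>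
      (\<exists>n. (par ^^ n) w = a \<and> (\<forall>m\<le>n. t \<in> bag ((par ^^ m) w))))" if "t \<in> terms I" for t
  proof -
    let ?A = "{v \<in> V. t \<in> bag v}"
    have "connected_in E ?A" "?A \<noteq> {}"
      using td that unfolding tree_decomposition_def by auto
    from connected_has_top[OF this] obtain a where a: "a \<in> ?A"
      "\<forall>w\<in>?A. \<exists>n. (par ^^ n) w = a \<and> (\<forall>m\<le>n. (par ^^ m) w \<in> ?A)" by auto
    show ?thesis by (rule exI[of _ a]) (use a in fastforce)
  qed
  then obtain top where top: "\<And>t. t \<in> terms I \<Longrightarrow> top t \<in> V"
    "\<And>t. t \<in> terms I \<Longrightarrow> t \<in> bag (top t)"
    "\<And>t w. t \<in> terms I \<Longrightarrow> w \<in> V \<Longrightarrow> t \<in> bag w \<Longrightarrow>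
      \<exists>n. (par ^^ n) w = top t \<and> (\<forall>m\<le>n. t \<in> bag ((par ^^ m) w))"
    by metis
  have top_anc: "anc (top t) w" if "t \<in> terms I" "w \<in> V" "t \<in> bag w" for t w
    using top(3)[OF that] unfolding anc_def by blast
  \<comment> \<open>The injection \<open>code\<close> breaks ties between terms with the same
    topmost bag.\<close>
  define lt where "lt y u \<longleftrightarrow> y \<in> terms I \<and> u \<in> terms I \<and> anc (top y) (top u) \<and>
    (top y = top u \<longrightarrow> code y < code u)" for y u
  have total: "x = y \<or> lt x y \<or> lt y x"
    if "x \<in> terms I" "y \<in> terms I" "anc (top x) (top y) \<or> anc (top y) (top x)" for x y
  proof (cases "top x = top y")
    case True
    then show ?thesis
      using inj_onD[OF inj, of x y] that(1,2) linorder_less_linear[of "code x" "code y"]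
      unfolding lt_def by auto
  next
    case False
    then show ?thesis using that unfolding lt_def by auto
  qed
  have common_bag: "\<exists>w\<in>V. x \<in> bag w \<and> y \<in> bag w \<and> x \<in> terms I \<and> y \<in> terms I"
    if adj: "adjacent I x y" for x y
  proof -
    obtain a where a: "a \<in> I" "x \<in> set (args a)" "y \<in> set (args a)"
      using adj unfolding adjacent_def by blast
    then have "x \<in> terms I" "y \<in> terms I" unfolding terms_def by auto
    moreover obtain w where "w \<in> V" "set (args a) \<subseteq> bag w"
      using td a(1) unfolding tree_decomposition_def by blast
    ultimately show ?thesis using a by blast
  qed
  have eo: "elimination_order I lt"
  proof
    show "\<not> lt x x" for x unfolding lt_def by auto
    show "lt x z" if "lt x y" "lt y z" for x y z
    proof -
      have "anc (top x) (top z)" using that anc_trans unfolding lt_def by blast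
      moreover have "code x < code z" if "top x = top z"
      proof -
        have "top y = top x"
          using \<open>lt x y\<close> \<open>lt y z\<close> that top(1) anc_antisym[of "top y" "top x"]
          unfolding lt_def by auto
        then show ?thesis using \<open>lt x y\<close> \<open>lt y z\<close> that unfolding lt_def by auto
      qed
      ultimately show ?thesis using that unfolding lt_def by blast
    qed
    \<comment> \<open>Every smaller term lies in the bag of one of the finitely many ancestors of
      \<open>top u\<close>.\<close>
    show "finite {y \<in> terms I. lt y u}" if "u \<in> terms I" for u
    proof (rule finite_subset)
      show "{y \<in> terms I. lt y u} \<subseteq> (\<Union>a\<in>{a. anc a (top u)}. bag a)"
        using top(2) unfolding lt_def by auto
      show "finite (\<Union>a\<in>{a. anc a (top u)}. bag a)"
        using finite_anc[OF top(1)[OF that]] bags anc_in[OF _ top(1)[OF that]] by auto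
    qed
    show "y = z \<or> lt y z \<or> lt z y"
      if "y \<in> terms I" "z \<in> terms I" "u \<in> terms I" "lt y u" "lt z u" for y z u
    proof -
      have "anc (top y) (top u)" "anc (top z) (top u)" using that(4,5) unfolding lt_def by auto
      then show ?thesis using total[OF that(1,2)] anc_linear by blast
    qed
    show "x = y \<or> lt x y \<or> lt y x" if adj: "adjacent I x y" for x y
    proof -
      obtain w where w: "w \<in> V" "x \<in> bag w" "y \<in> bag w" "x \<in> terms I" "y \<in> terms I"
        using common_bag[OF adj] by blast
      then have "anc (top x) w" "anc (top y) w" using top_anc by auto
      then show ?thesis using total[OF w(4,5)] anc_linear by blast
    qed
  qed
  interpret elimination_order I lt by (rule eo)
  have "card (separator u) \<le> k" if u: "u \<in> terms I" for u
  proof -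
    \<comment> \<open>A bag \<open>w\<close> shared by \<open>x\<close> and \<open>y\<close> lies
      below \<open>top u\<close>. All bags from \<open>w\<close> up to \<open>top y\<close> contain
      \<open>y\<close>, and \<open>top u\<close> is among them because \<open>top y\<close> is an
      ancestor of \<open>top u\<close>.\<close>
    have "separator u \<subseteq> bag (top u)"
    proof
      fix y assume "y \<in> separator u"
      then obtain x where yx: "y \<in> terms I" "lt y u" "x \<in> terms I" "x = u \<or> lt u x" "adjacent I x y"
        unfolding separator_def below_def above_def by blast
      obtain w where w: "w \<in> V" "x \<in> bag w" "y \<in> bag w" using common_bag[OF yx(5)] by blast
      have "anc (top u) (top x)" using yx(4) unfolding lt_def by auto
      then have "anc (top u) w" using top_anc[OF yx(3) w(1,2)] anc_trans by blast
      then obtain m where m: "(par ^^ m) w = top u" unfolding anc_def by blast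
      obtain n where n: "(par ^^ n) w = top y" "\<forall>i\<le>n. y \<in> bag ((par ^^ i) w)"
        using top(3)[OF yx(1) w(1,3)] by blast
      show "y \<in> bag (top u)"
      proof (cases "m \<le> n")
        case True
        then show ?thesis using n(2) m by metis
      next
        case False
        then have "(par ^^ (m - n)) (top y) = top u"
          using m n(1) by (metis comp_apply funpow_add le_add_diff_inverse2 nat_le_linear)
        then have "anc (top u) (top y)" unfolding anc_def by blast
        moreover have "anc (top y) (top u)" using yx(2) unfolding lt_def by blast
        ultimately have "top u = top y" using anc_antisym top(1)[OF u] by blast
        then show ?thesis using top(2)[OF yx(1)] by simp
      qed
    qed
    then show ?thesis using bags[OF top(1)[OF u]] by (meson card_mono le_trans)
  qed
  with eo show ?thesis by blast
qed

section \<open>Greedy choice of slots\<close>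

context elimination_order
begin

lemma below_psubset: "y \<in> below u \<Longrightarrow> below y \<subset> below u"
  unfolding below_def using lt_trans lt_irrefl by blast

lemma finite_below': "u \<in> terms I \<Longrightarrow> finite (below u)"
  using finite_below unfolding below_def .

lemma card_below_less: "y \<in> below u \<Longrightarrow> u \<in> terms I \<Longrightarrow> card (below y) < card (below u)"
  using below_psubset finite_below' psubset_card_mono by metis

text \<open>Greedy coloring by recursion along the order: the at most \<open>k\<close> slots used in
  the separator leave one of the \<open>k + 1\<close> values up to \<open>k\<close> free.\<close>

lemma exists_slots:
  assumes "\<And>u. u \<in> terms I \<Longrightarrow> card (separator u) \<le> k"
  shows "\<exists>slot :: ('c, 'n) trm \<Rightarrow> nat. \<forall>u\<in>terms I. slot u \<le> k \<and> slot u \<notin> slot ` separator u"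
proof -
  define R where "R = {(y, u). u \<in> terms I \<and> y \<in> below u}"
  have "R \<subseteq> measure (\<lambda>u. card (below u))"
    unfolding R_def using card_below_less by auto
  then have wf: "wf R" using wf_subset wf_measure by blast
  define F where "F g u = (LEAST i. i \<notin> g ` separator u)" for g :: "('c, 'n) trm \<Rightarrow> nat" and u
  define slot where "slot = wfrec R F"
  have "slot u \<le> k \<and> slot u \<notin> slot ` separator u" if u: "u \<in> terms I" for u
  proof -
    have sub: "separator u \<subseteq> below u" unfolding separator_def by blast
    \<comment> \<open>The recursion exposes only values at smaller terms, and the separator consists
      of such terms.\<close>
    have "cut slot R u ` separator u = slot ` separator u"
      by (rule image_cong) (use sub u in \<open>auto simp: cut_def R_def\<close>)
    then have eq: "slot u = (LEAST i. i \<notin> slot ` separator u)"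
      using wfrec[OF wf, of F u] unfolding slot_def F_def by simp
    have fin: "finite (slot ` separator u)" using sub finite_below'[OF u] finite_subset by blast
    have "card (slot ` separator u) \<le> k"
      using assms[OF u] card_image_le[of "separator u" slot] sub finite_below'[OF u]
      by (meson finite_subset le_trans)
    then have "\<not> {..k} \<subseteq> slot ` separator u"
      using card_mono[OF fin, of "{..k}"] by auto
    then obtain i where i: "i \<le> k" "i \<notin> slot ` separator u" by auto
    have "(LEAST i. i \<notin> slot ` separator u) \<le> i" by (rule Least_le) (rule i(2))
    moreover have "(LEAST i. i \<notin> slot ` separator u) \<notin> slot ` separator u"
      by (rule LeastI) (rule i(2))
    ultimately show ?thesis unfolding eq[symmetric] using i(1) by simp
  qed
  then show ?thesis by blast
qed

end


section \<open>The decorated tree of an elimination order\<close>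

text \<open>States of a deterministic automaton that generates the infinite tree from the root
  downwards. \<open>Recs\<close> and \<open>Adds\<close> carry the operations still to be written,
  \<open>Dummy\<close> generates an infinite tree of sums without elements, and \<open>Dead\<close>
  the void tree.\<close>

datatype ('p, 't) state =
  Recs "(nat \<times> nat) list" 't
| Adds "('p \<times> nat list) list" "'t option"
| Leaf 't
| Comb "'t set" nat
| Dummy
| Dead

text \<open>Recolorings act one after another, but since \<open>g\<close> is idempotent a color
  \<open>g c\<close> survives all later ones. The list therefore acts like a simultaneous
  recoloring, whatever its order and repetitions.\<close>

lemma foldr_recolor:
  assumes "inj_on enc C" "c \<in> C" "set cs \<subseteq> C" "\<And>c. c \<in> C \<Longrightarrow> g c \<in> C \<and> g (g c) = g c"
  shows "foldr (\<lambda>(k, k') j. if j = k then k' else j) (map (\<lambda>c. (enc c, enc (g c))) cs) (enc c) =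
    enc (if c \<in> set cs then g c else c)"
  using assms(3)
proof (induction cs)
  case (Cons d cs)
  then have d: "d \<in> C" by simp
  show ?case
  proof (cases "c \<in> set cs")
    case True
    have "enc (g c) = enc d \<longleftrightarrow> g c = d" using assms(1,2,4) d by (auto dest: inj_onD)
    then show ?thesis using True Cons assms(2,4) by auto
  next
    case False
    have "enc c = enc d \<longleftrightarrow> c = d" using assms(1,2) d by (auto dest: inj_onD)
    then show ?thesis using False Cons by auto
  qed
qed simp

section \<open>The coloring and the generating automaton\<close>

locale slotted_elimination_order = elimination_order I lt
  for I :: "('p, 'c, 'n) atom set" and lt +
  fixes S :: "'p sgn" and slot :: "('c, 'n) trm \<Rightarrow> nat" and k :: nat and code :: "('c, 'n) trm \<Rightarrow> nat"
  assumes sig: "signature S" and bin: "binary_signature S" and inst: "is_instance S I"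
    and slot_le: "u \<in> terms I \<Longrightarrow> slot u \<le> k"
    and slot_separator: "u \<in> terms I \<Longrightarrow> slot u \<notin> slot ` separator u"
    and inj_code: "inj_on code (terms I)"
begin

text \<open>The Boolean tells whether \<open>x\<close> comes first, and the partner \<open>y\<close>
  enters only through its slot. Loops are left out: like unary atoms they are handled by the flag of
  the color.\<close>

definition links :: "('c, 'n) trm \<Rightarrow> ('c, 'n) trm set \<Rightarrow> ('p \<times> bool \<times> nat) set" where
  "links x A = {(R, d, slot y) | R d y.
     y \<in> A \<and> y \<noteq> x \<and> Atom R (if d then [x, y] else [y, x]) \<in> I}"

definition upto :: "('c, 'n) trm \<Rightarrow> ('c, 'n) trm set" where
  "upto u = insert u (below u)"

text \<open>A finite set that depends only on the signature and on \<open>k\<close>.\<close>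

definition colors :: "(bool \<times> ('p \<times> bool \<times> nat) set) set" where
  "colors = UNIV \<times> Pow (preds S \<times> UNIV \<times> {..k})"

definition enc :: "bool \<times> ('p \<times> bool \<times> nat) set \<Rightarrow> nat" where
  "enc = to_nat_on colors"

text \<open>\<open>None\<close> stands for a virtual root of the whole forest.\<close>

fun cont :: "('c, 'n) trm option \<Rightarrow> ('c, 'n) trm set" where
  "cont None = terms I"
| "cont (Some u) = above u"

text \<open>The color of \<open>x\<close> just below the recoloring stage of \<open>p\<close>; the flag singles out \<open>p\<close> itself.\<close>

fun pre :: "('c, 'n) trm option \<Rightarrow> ('c, 'n) trm \<Rightarrow> bool \<times> ('p \<times> bool \<times> nat) set" where
  "pre None x = (False, links x {})"
| "pre (Some u) x = (x = u, links x (upto u))"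

definition forget :: "('c, 'n) trm \<Rightarrow> bool \<times> ('p \<times> bool \<times> nat) set \<Rightarrow> bool \<times> ('p \<times> bool \<times> nat) set" where
  "forget u c = (False, {(R, d, i) \<in> snd c. i \<noteq> slot u})"

text \<open>The enumeration may be arbitrary: \<open>forget u\<close> is idempotent, so
  \<open>foldr_recolor\<close> applies.\<close>

definition recs :: "('c, 'n) trm \<Rightarrow> (nat \<times> nat) list" where
  "recs u = map (\<lambda>c. (enc c, enc (forget u c))) (SOME cs. set cs = colors)"

text \<open>Performing every sound addition at every node leaves only completeness to be proved.\<close>

definition sound_adds :: "('c, 'n) trm option \<Rightarrow> ('p \<times> nat list) set" where
  "sound_adds p = {(R, ks). R \<in> preds S \<and> length ks = arity S R \<and> set ks \<subseteq> enc ` colors \<and>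
     (\<forall>xs. length xs = length ks \<and> (\<forall>i<length ks. xs ! i \<in> cont p \<and> enc (pre p (xs ! i)) = ks ! i)
        \<longrightarrow> Atom R xs \<in> I)}"

definition adds :: "('c, 'n) trm option \<Rightarrow> ('p \<times> nat list) list" where
  "adds p = (SOME l. set l = sound_adds p)"

text \<open>An exhausted list still occupies a node decorated \<open>Plus\<close>. After the
  additions at \<open>u\<close> this node joins the leaf of \<open>u\<close> with the comb of its
  children.\<close>

fun out :: "('p, ('c, 'n) trm) state \<Rightarrow> ('p, 'c) dec" where
  "out (Recs ((i, j) # rs) u) = Recolor i j"
| "out (Recs [] u) = Plus"
| "out (Adds ((R, ks) # as) p) = Add R ks"
| "out (Adds [] p) = Plus"
| "out (Leaf u) = Intro (case u of Const c \<Rightarrow> Some c | Null _ \<Rightarrow> None) (enc (pre (Some u) u))"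
| "out (Comb A i) = Plus"
| "out Dummy = Plus"
| "out Dead = Void"

text \<open>
  Below \<open>u\<close> hangs an infinite comb, whose \<open>i\<close>-th tooth carries the term with code \<open>i\<close> if it is a
  child of \<open>u\<close>, and an infinite tree without elements otherwise. Children of \<open>u\<close> are recognized by
  \<^term>\<open>below c = upto u\<close>.
\<close>

fun child :: "('p, ('c, 'n) trm) state \<Rightarrow> bool \<Rightarrow> ('p, ('c, 'n) trm) state" where
  "child (Recs (r # rs) u) b = (if b then Dead else Recs rs u)"
| "child (Recs [] u) b = (if b then Dummy else Adds (adds (Some u)) (Some u))"
| "child (Adds (a # as) p) b = (if b then Dead else Adds as p)"
| "child (Adds [] (Some u)) b = (if b then Comb (upto u) 0 else Leaf u)"
| "child (Adds [] None) b = (if b then Comb {} 0 else Dummy)"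
| "child (Leaf u) b = Dead"
| "child (Comb A i) b = (if b then Comb A (Suc i)
     else if i \<in> code ` terms I \<and> below (inv_into (terms I) code i) = A
     then Recs (recs (inv_into (terms I) code i)) (inv_into (terms I) code i) else Dummy)"
| "child Dummy b = Dummy"
| "child Dead b = Dead"

definition run :: "('p, ('c, 'n) trm) state \<Rightarrow> node \<Rightarrow> ('p, ('c, 'n) trm) state" where
  "run q s = foldl child q s"

abbreviation start :: "('p, ('c, 'n) trm) state" where
  "start \<equiv> Adds (adds None) None"

definition tree :: "node \<Rightarrow> ('p, 'c) dec" where
  "tree s = out (run start s)"

text \<open>Predicts which terms have their leaf in the subtree generated from a state;
  \<open>content_iff_addr\<close> confirms this for the actual tree.\<close>

fun content :: "('p, ('c, 'n) trm) state \<Rightarrow> ('c, 'n) trm set" where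
  "content (Recs rs u) = above u"
| "content (Adds as p) = cont p"
| "content (Leaf u) = {u}"
| "content (Comb A i) = (\<Union>c\<in>{c \<in> terms I. i \<le> code c \<and> below c = A}. above c)"
| "content Dummy = {}"
| "content Dead = {}"

fun good :: "('p, ('c, 'n) trm) state \<Rightarrow> bool" where
  "good (Recs rs u) \<longleftrightarrow> u \<in> terms I \<and> set rs \<subseteq> enc ` colors \<times> enc ` colors"
| "good (Adds as p) \<longleftrightarrow> p \<in> insert None (Some ` terms I) \<and> set as \<subseteq> sound_adds p"
| "good (Leaf u) \<longleftrightarrow> u \<in> terms I"
| "good (Comb A i) \<longleftrightarrow> True"
| "good Dummy \<longleftrightarrow> True"
| "good Dead \<longleftrightarrow> True"

text \<open>The predicted color of \<open>x\<close> at a node with this state. Later entries of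
  \<open>rs\<close> sit lower in the tree and act first, as in \<open>foldr\<close>.\<close>

fun state_color :: "('p, ('c, 'n) trm) state \<Rightarrow> ('c, 'n) trm \<Rightarrow> nat" where
  "state_color (Recs rs u) x =
     foldr (\<lambda>(k, k') j. if j = k then k' else j) rs (enc (pre (Some u) x))"
| "state_color (Adds as p) x = enc (pre p x)"
| "state_color (Leaf u) x = enc (pre (Some u) u)"
| "state_color (Comb A i) x = enc (False, links x A)"
| "state_color Dummy x = 0"
| "state_color Dead x = 0"

section \<open>Colors, forgetting of slots, and siblings\<close>

lemma above_subset: "above u \<subseteq> terms I"
  unfolding above_def by blast

lemma self_above: "u \<in> terms I \<Longrightarrow> u \<in> above u"
  unfolding above_def by blast

lemma finite_colors: "finite colors"
  using sig unfolding colors_def signature_def by simp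

lemma inj_enc: "inj_on enc colors"
  unfolding enc_def using finite_colors by (intro inj_on_to_nat_on countable_finite)

lemma enc_eq_iff: "c \<in> colors \<Longrightarrow> d \<in> colors \<Longrightarrow> enc c = enc d \<longleftrightarrow> c = d"
  using inj_enc by (auto dest: inj_onD)

lemma links_color: "A \<subseteq> terms I \<Longrightarrow> (b, links x A) \<in> colors"
  using inst slot_le unfolding colors_def links_def is_instance_def by force

lemma upto_subset: "u \<in> terms I \<Longrightarrow> upto u \<subseteq> terms I"
  unfolding upto_def below_def by blast

lemma pre_color: "p \<in> insert None (Some ` terms I) \<Longrightarrow> pre p x \<in> colors"
  using links_color[OF upto_subset] links_color[of "{}"] by (cases p) auto

lemma forget_color: "c \<in> colors \<Longrightarrow> forget u c \<in> colors"
  unfolding colors_def forget_def by auto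

text \<open>Arities at most 2 and finitely many colors leave finitely many candidates, so an
  enumeration exists for \<open>SOME\<close> to pick.\<close>

lemma set_adds: "set (adds p) = sound_adds p"
proof -
  have "sound_adds p \<subseteq> preds S \<times> {ks. set ks \<subseteq> enc ` colors \<and> length ks \<le> 2}"
    using bin unfolding sound_adds_def binary_signature_def by auto
  moreover have "finite (preds S)" using sig unfolding signature_def by blast
  ultimately have "finite (sound_adds p)"
    using finite_lists_length_le[of "enc ` colors" 2] finite_colors
    by (meson finite_SigmaI finite_imageI finite_subset)
  then show ?thesis unfolding adds_def using finite_list by (metis (mono_tags) someI_ex)
qed

lemma recs_eq: "\<exists>cs. set cs = colors \<and> recs u = map (\<lambda>c. (enc c, enc (forget u c))) cs"
  unfolding recs_def using finite_list[OF finite_colors] by (metis (mono_tags) someI_ex)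

text \<open>The link puts \<open>y\<close> into \<open>separator u\<close>.\<close>

lemma link_slot:
  assumes "u \<in> terms I" "y \<in> below u" "x \<in> above u" "Atom R (if d then [x, y] else [y, x]) \<in> I"
  shows "slot y \<noteq> slot u"
proof -
  have "adjacent I x y" unfolding adjacent_def
    by (rule bexI[OF _ assms(4)]) (auto split: if_splits)
  then have "y \<in> separator u" using assms unfolding separator_def by blast
  then show ?thesis using slot_separator[OF assms(1)] by (metis image_eqI)
qed

text \<open>By \<open>link_slot\<close> no partner of \<open>x\<close> in \<open>below u\<close>
  shares the slot of \<open>u\<close>, so erasing that slot removes exactly the links to
  \<open>u\<close>.\<close>

lemma forget_pre:
  assumes "u \<in> terms I" "x \<in> above u"
  shows "forget u (pre (Some u) x) = (False, links x (below u))"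
proof -
  have "{(R, d, i) \<in> links x (upto u). i \<noteq> slot u} = links x (below u)"
  proof (rule set_eqI)
    fix p :: "'p \<times> bool \<times> nat"
    obtain R d i where p: "p = (R, d, i)" by (cases p)
    show "p \<in> {(R, d, i) \<in> links x (upto u). i \<noteq> slot u} \<longleftrightarrow> p \<in> links x (below u)"
      unfolding p links_def upto_def
      using link_slot[OF assms(1) _ assms(2), of _ R d] by auto
  qed
  then show ?thesis by (simp add: forget_def)
qed

text \<open>The outcome is the color that \<open>state_color\<close> assigns at the comb from which
  \<open>u\<close> hangs.\<close>

lemma recolored:
  assumes "u \<in> terms I" "x \<in> above u"
  shows "state_color (Recs (recs u) u) x = enc (False, links x (below u))"
proof -
  obtain cs where cs: "set cs = colors" "recs u = map (\<lambda>c. (enc c, enc (forget u c))) cs"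
    using recs_eq by blast
  have "pre (Some u) x \<in> colors" using pre_color assms(1) by blast
  then have "state_color (Recs (recs u) u) x = enc (forget u (pre (Some u) x))"
    using foldr_recolor[OF inj_enc, of "pre (Some u) x" cs "forget u"] forget_color cs
    by (auto simp: forget_def)
  then show ?thesis using forget_pre[OF assms] by simp
qed

text \<open>Both terms lie on the branch to \<open>x\<close> and are comparable, but
  \<open>lt c d\<close> would put \<open>c\<close> into \<open>below d\<close> and not into
  \<open>below c\<close>. Distinct siblings thus have disjoint subtrees.\<close>

lemma above_same_below:
  assumes "c \<in> terms I" "d \<in> terms I" "below c = below d" "x \<in> above c" "x \<in> above d"
  shows "c = d"
proof -
  have "\<not> lt c d" "\<not> lt d c" using assms(1-3) lt_irrefl unfolding below_def by auto
  then show ?thesis using assms lt_linear[of c d x] unfolding above_def by auto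
qed

section \<open>Local correctness of the automaton\<close>

lemma good_child: "good q \<Longrightarrow> good (child q b)"
proof (cases "(q, b)" rule: child.cases)
  case (7 A i b)
  have "set (recs u) \<subseteq> enc ` colors \<times> enc ` colors" for u
    using recs_eq[of u] forget_color by auto
  then show ?thesis using 7 by (auto intro: inv_into_into)
qed (auto simp: set_adds split: if_splits)

lemma above_child:
  assumes "c \<in> terms I" "below c = upto u" "x \<in> above c"
  shows "x \<in> above u" "x \<noteq> u"
proof -
  have "lt u c" using assms(2) unfolding upto_def below_def by auto
  then show "x \<in> above u" "x \<noteq> u"
    using assms(3) lt_trans lt_irrefl unfolding above_def by blast+
qed

lemma content_child: "good q \<Longrightarrow> content (child q b) \<subseteq> content q"
proof (cases "(q, b)" rule: child.cases)
  case (4 u b)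
  moreover assume "good q"
  ultimately show ?thesis using above_child(1) self_above by auto
next
  case (5 b)
  then show ?thesis using above_subset by auto
next
  case (7 A i b)
  show ?thesis
  proof (cases "i \<in> code ` terms I")
    case True
    then show ?thesis using 7 inv_into_into[OF True] f_inv_into_f[OF True] by auto
  next
    case False
    with 7 show ?thesis by auto
  qed
qed auto

text \<open>After the additions at \<open>u\<close> the left branch holds \<open>u\<close> and the
  right one only larger terms; at a comb, the tooth and the rest hold subtrees of distinct
  siblings.\<close>

lemma content_disjoint: "good q \<Longrightarrow> content (child q False) \<inter> content (child q True) = {}"
proof (cases "(q, True)" rule: child.cases)
  case (4 u b)
  then show ?thesis using above_child(2) by fastforce
next
  case (7 A i b)
  let ?c = "inv_into (terms I) code i"
  have False if d: "i \<in> code ` terms I" "below ?c = A" "d \<in> terms I" "Suc i \<le> code d" "below d = A"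
    "x \<in> above ?c" "x \<in> above d" for d x
  proof -
    have "?c = d"
      by (rule above_same_below[OF inv_into_into[OF d(1)] d(3) _ d(6,7)]) (simp add: d)
    then show False using f_inv_into_f[OF d(1)] d(4) by simp
  qed
  then show ?thesis using 7 by auto
qed auto

text \<open>One step of the bottom-up computation of colors agrees with the prediction;
  \<open>path_color_tree\<close> iterates this.\<close>

lemma color_child:
  assumes "x \<in> content (child q b)"
  shows "recolor (out q) (state_color (child q b) x) = state_color q x"
proof (cases "(q, b)" rule: child.cases)
  case (1 r rs u b)
  then show ?thesis using assms by (cases r) auto
next
  case (3 a as p b)
  then show ?thesis using assms by (cases a) auto
next
  \<comment> \<open>A term of the comb differs from \<open>u\<close>, so its flag under
    \<open>pre (Some u)\<close> is false, as the comb predicts.\<close>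
  case (4 u b)
  then show ?thesis using assms above_child(2) by (auto split: if_splits)
next
  case (7 A i b)
  then show ?thesis
    using assms recolored inv_into_into[of i code "terms I"]
    by (auto split: if_splits simp del: state_color.simps(1))
qed (use assms in \<open>auto split: if_splits\<close>)

lemma children_ok_child: "children_ok (out q) (out (child q False)) (out (child q True))"
proof -
  have *: "out (Recs rs u) \<noteq> Void" for rs u
    by (cases rs) auto
  have **: "out (Adds as p) \<noteq> Void" for as p by (cases as) auto
  have "out (child (Adds [] p) b) \<noteq> Void" for p b by (cases p) auto
  with * ** show ?thesis by (cases q rule: out.cases) auto
qed

lemma admissible_out:
  "good q \<Longrightarrow> admissible S (enc ` colors) {c. Const c \<in> terms I} (out q)"
proof (cases q rule: out.cases)
  case (5 u)
  moreover assume "good q"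
  ultimately show ?thesis using pre_color[of "Some u" u] by (cases u) auto
qed (auto simp: sound_adds_def)

section \<open>Runs and uniqueness of leaves\<close>

lemma run_Nil [simp]: "run q [] = q"
  and run_Cons [simp]: "run q (b # s) = run (child q b) s"
  and run_append: "run q (s @ u) = run (run q s) u"
  unfolding run_def by auto

lemma run_Dead [simp]: "run Dead s = Dead"
  by (induction s) auto

lemma good_run: "good q \<Longrightarrow> good (run q s)"
  by (induction s arbitrary: q) (auto intro: good_child)

lemma content_run: "good q \<Longrightarrow> content (run q s) \<subseteq> content q"
proof (induction s arbitrary: q)
  case (Cons b s)
  then show ?case using content_child[of q b] good_child[of q b] by force
qed simp

lemma good_start: "good start"
  using set_adds by simp

text \<open>Disjointness of sibling contents confines the nodes that contain \<open>x\<close> to a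
  single branch.\<close>

lemma content_comparable:
  "good q \<Longrightarrow> x \<in> content (run q s) \<Longrightarrow> x \<in> content (run q s') \<Longrightarrow>
    \<exists>u. s' = s @ u \<or> s = s' @ u"
proof (induction s arbitrary: q s')
  case (Cons b s)
  show ?case
  proof (cases s')
    case (Cons b' t)
    have "x \<in> content (child q b)" "x \<in> content (child q b')"
      using Cons.prems(2,3) Cons content_run[OF good_child[OF Cons.prems(1)], of b s]
        content_run[OF good_child[OF Cons.prems(1)], of b' t] by auto
    then have "b = b'" using content_disjoint[OF Cons.prems(1)] by (cases b; cases b') auto
    then show ?thesis using Cons.IH[OF good_child[OF Cons.prems(1)], of b t] Cons.prems Cons by auto
  qed simp
qed auto

text \<open>Strictly beneath a leaf all states are \<open>Dead\<close> and have no content, so of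
  two comparable nodes the leaf is the lower one.\<close>

lemma leaf_below:
  assumes "x \<in> content (run start s)" "run start a = Leaf x"
  shows "\<exists>u. a = s @ u"
proof -
  obtain u where "a = s @ u \<or> s = a @ u"
    using content_comparable[OF good_start, of x s a] assms by auto
  moreover have "u = []" if "s = a @ u"
    using assms that by (cases u) (auto simp: run_append)
  ultimately show ?thesis by auto
qed

lemma leaf_unique: "run start a = Leaf x \<Longrightarrow> run start b = Leaf x \<Longrightarrow> a = b"
  using leaf_below[of x a b] leaf_below[of x b a] by auto

section \<open>Reachability of all terms\<close>

definition reachable :: "('p, ('c, 'n) trm) state \<Rightarrow> bool" where
  "reachable q \<longleftrightarrow> (\<exists>s. run start s = q)"

lemma reachable_child: "reachable q \<Longrightarrow> child q b = q' \<Longrightarrow> reachable q'"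
  unfolding reachable_def by (metis run_Cons run_Nil run_append)

lemma reachable_Recs: "reachable (Recs rs u) \<Longrightarrow> reachable (Adds (adds (Some u)) (Some u))"
proof (induction rs)
  case Nil
  then show ?case using reachable_child[of _ False] by simp
next
  case (Cons r rs)
  then show ?case using reachable_child[of _ False] by simp
qed

lemma reachable_Adds: "reachable (Adds (as @ as') p) \<Longrightarrow> reachable (Adds as' p)"
proof (induction as)
  case (Cons a as)
  then show ?case using reachable_child[of _ False] by simp
qed simp

lemma reachable_Adds_Nil: "reachable (Adds as p) \<Longrightarrow> reachable (Adds [] p)"
  using reachable_Adds[of as "[]"] by simp

lemma reachable_Comb: "reachable (Comb A 0) \<Longrightarrow> reachable (Comb A i)"
proof (induction i)
  case (Suc i)
  then show ?case using reachable_child[of _ True] by simp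
qed simp

text \<open>The finite chain \<open>below u\<close> has a largest element, the parent of
  \<open>u\<close>. It is found by maximizing the number of terms below.\<close>

lemma below_eq_upto:
  assumes "u \<in> terms I" "below u \<noteq> {}"
  shows "\<exists>m\<in>below u. below u = upto m"
proof -
  obtain m where m: "m \<in> below u" "\<And>y. y \<in> below u \<Longrightarrow> card (below y) \<le> card (below m)"
    using obtains_MAX[OF finite_below'[OF assms(1)] assms(2), of "\<lambda>y. card (below y)"]
      finite_below'[OF assms(1)] by (metis Max_ge finite_imageI imageI)
  have "y \<in> upto m" if y: "y \<in> below u" for y
  proof -
    have "\<not> lt m y"
      using m(2)[OF y] card_below_less[of m y] m(1) y unfolding below_def by auto
    then show ?thesis
      using lt_linear[of m y u] m(1) y assms(1) unfolding upto_def below_def by auto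
  qed
  moreover have "upto m \<subseteq> below u"
    using m(1) below_psubset unfolding upto_def by blast
  ultimately show ?thesis using m(1) by blast
qed

text \<open>By induction on the number of terms below \<open>u\<close>: from the stage of its
  parent, or of the virtual root, the comb leads to the tooth numbered
  \<open>code u\<close>.\<close>

lemma reachable_adds:
  assumes "p \<in> insert None (Some ` terms I)"
  shows "reachable (Adds (adds p) p)"
proof -
  have start: "reachable start" unfolding reachable_def by (rule exI[of _ "[]"]) simp
  have "reachable (Adds (adds (Some u)) (Some u))" if "u \<in> terms I" for u
    using that
  proof (induction "card (below u)" arbitrary: u rule: less_induct)
    case less
    have "reachable (Comb (below u) 0)"
    proof (cases "below u = {}")
      case True
      then show ?thesis
        using reachable_child[OF reachable_Adds_Nil[OF start], of True] by simp
    next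
      case False
      then obtain m where m: "m \<in> below u" "below u = upto m" using below_eq_upto less.prems by blast
      then have "reachable (Adds (adds (Some m)) (Some m))"
        using less.hyps[of m] card_below_less[of m u] less.prems unfolding below_def by auto
      then show ?thesis
        using reachable_child[OF reachable_Adds_Nil, of _ _ True] m(2) by simp
    qed
    then have "reachable (Comb (below u) (code u))" by (rule reachable_Comb)
    moreover have "child (Comb (below u) (code u)) False = Recs (recs u) u"
      using less.prems inj_code by (simp add: inv_into_f_f)
    ultimately show ?case using reachable_child reachable_Recs by blast
  qed
  then show ?thesis using assms start by auto
qed

lemma reachable_Leaf: "u \<in> terms I \<Longrightarrow> \<exists>a. run start a = Leaf u"
  using reachable_child[OF reachable_Adds_Nil[OF reachable_adds], of "Some u" False "Leaf u"]
  unfolding reachable_def by simp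

section \<open>Terms as elements of the decorated tree\<close>

definition addr :: "('c, 'n) trm \<Rightarrow> node" where
  "addr x = (SOME a. run start a = Leaf x)"

definition hom :: "('c, 'n) trm \<Rightarrow> ('c, node) trm" where
  "hom x = (case x of Const c \<Rightarrow> Const c | Null _ \<Rightarrow> Null (addr x))"

lemma run_addr: "x \<in> terms I \<Longrightarrow> run start (addr x) = Leaf x"
  unfolding addr_def using reachable_Leaf by (rule someI_ex)

lemma addr_eq: "run start a = Leaf x \<Longrightarrow> addr x = a"
  unfolding addr_def by (rule leaf_unique[OF someI[of "\<lambda>a. run start a = Leaf x"]])

lemma out_Intro:
  "out q = Intro c j \<Longrightarrow>
    \<exists>x. q = Leaf x \<and> c = (case x of Const c \<Rightarrow> Some c | Null _ \<Rightarrow> None) \<and> j = enc (pre (Some x) x)"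
  by (cases q rule: out.cases) auto

lemma well_decorated_tree:
  "well_decorated S (enc ` colors) {c. Const c \<in> terms I} tree"
  unfolding well_decorated_def
proof (intro conjI allI impI)
  show "admissible S (enc ` colors) {c. Const c \<in> terms I} (tree s)" for s
    unfolding tree_def by (rule admissible_out[OF good_run[OF good_start]])
  show "children_ok (tree s) (tree (s @ [False])) (tree (s @ [True]))" for s
    using children_ok_child unfolding tree_def by (simp add: run_append)
  show "s = s'" if "tree s = Intro (Some c) j \<and> tree s' = Intro (Some c) j'" for s s' c j j'
  proof -
    have "run start a = Leaf (Const c)" if a: "tree a = Intro (Some c) i" for a i
    proof -
      obtain x where "run start a = Leaf x" "Some c = (case x of Const c \<Rightarrow> Some c | Null _ \<Rightarrow> None)"
        using out_Intro[OF a[unfolded tree_def]] by blast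
      then show ?thesis by (cases x) auto
    qed
    then have "run start s = Leaf (Const c)" "run start s' = Leaf (Const c)" using that by auto
    then show ?thesis using leaf_unique by blast
  qed
qed

lemma introduces_tree:
  "introduces tree a e j \<longleftrightarrow> (\<exists>x. run start a = Leaf x \<and> e = hom x \<and> j = enc (pre (Some x) x))"
proof
  assume "introduces tree a e j"
  then show "\<exists>x. run start a = Leaf x \<and> e = hom x \<and> j = enc (pre (Some x) x)"
    by cases (auto dest!: out_Intro simp: tree_def hom_def addr_eq split: trm.splits)
next
  assume "\<exists>x. run start a = Leaf x \<and> e = hom x \<and> j = enc (pre (Some x) x)"
  then obtain x where "run start a = Leaf x" "e = hom x" "j = enc (pre (Some x) x)" by blast
  then show "introduces tree a e j"
    by (cases x) (auto simp: hom_def addr_eq tree_def intro!: introduces.intros)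
qed

text \<open>Contents shrink downwards, which gives one direction; the other is
  \<open>leaf_below\<close>.\<close>

lemma content_iff_addr:
  assumes "x \<in> terms I"
  shows "x \<in> content (run start s) \<longleftrightarrow> (\<exists>u. addr x = s @ u)"
proof
  assume "\<exists>u. addr x = s @ u"
  then obtain u where "run (run start s) u = Leaf x" using run_addr[OF assms] run_append by metis
  then show "x \<in> content (run start s)"
    using content_run[OF good_run[OF good_start], of s u] by auto
qed (use leaf_below run_addr[OF assms] in blast)

lemma content_terms: "content (run start s) \<subseteq> terms I"
  using content_run[OF good_start, of s] by simp

lemma leaf_term: "run start a = Leaf x \<Longrightarrow> x \<in> terms I"
  using content_terms[of a] by auto

lemma elements_tree: "elements tree s = hom ` content (run start s)"
proof -
  have "e \<in> elements tree s \<longleftrightarrow> (\<exists>x u. run start (s @ u) = Leaf x \<and> e = hom x)" for e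
    unfolding elements_def introduces_tree by auto
  moreover have "(\<exists>u. run start (s @ u) = Leaf x) \<longleftrightarrow> x \<in> content (run start s)" for x
  proof (cases "x \<in> terms I")
    case True
    then show ?thesis using content_iff_addr[OF True] addr_eq run_addr[OF True] by metis
  next
    case False
    then show ?thesis using content_terms leaf_term by blast
  qed
  ultimately show ?thesis by blast
qed

lemma path_color_tree:
  "run start (s @ u) = Leaf x \<Longrightarrow>
    path_color tree s u (enc (pre (Some x) x)) = state_color (run start s) x"
proof (induction u arbitrary: s)
  case (Cons b u)
  have "x \<in> content (run start (s @ [b]))"
    using content_run[OF good_run[OF good_start], of "s @ [b]" u] Cons.prems
    by (simp add: run_append)
  then show ?case
    using Cons.IH[of "s @ [b]"] Cons.prems color_child[of x "run start s" b]
    by (simp add: run_append tree_def)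
qed simp

lemma color_tree:
  assumes "x \<in> content (run start s)"
  shows "color tree s (hom x) = state_color (run start s) x"
proof -
  have x: "x \<in> terms I" using assms content_terms by blast
  then obtain u where u: "addr x = s @ u" using assms content_iff_addr by blast
  then have "has_color tree s (hom x) (state_color (run start s) x)"
    using path_color_tree[of s u x] run_addr[OF x]
    unfolding has_color_def introduces_tree by metis
  then show ?thesis using has_color_iff_color[OF well_decorated_tree] by blast
qed

lemma inj_hom: "inj_on hom (terms I)"
proof (rule inj_onI)
  fix x y assume xy: "x \<in> terms I" "y \<in> terms I" "hom x = hom y"
  have "x = y" if "addr x = addr y"
    using run_addr[OF xy(1)] run_addr[OF xy(2)] unfolding that by (metis state.inject(3))
  then show "x = y" using xy(3) by (cases x; cases y) (simp_all add: hom_def)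
qed

section \<open>Soundness and completeness of the added atoms\<close>

lemma sound_adds_tree:
  assumes "tree s = Add R ks"
  shows "\<exists>p. (R, ks) \<in> sound_adds p \<and> content (run start s) = cont p \<and>
    (\<forall>x. state_color (run start s) x = enc (pre p x))"
proof -
  obtain as p where "run start s = Adds ((R, ks) # as) p"
    using assms unfolding tree_def by (cases "run start s" rule: out.cases) auto
  moreover from this have "(R, ks) \<in> sound_adds p" using good_run[OF good_start, of s] by simp
  ultimately show ?thesis by auto
qed

text \<open>Pulled back along \<open>hom\<close>, an added tuple meets the condition in
  \<open>sound_adds\<close> and so is an atom of \<open>I\<close>.\<close>

lemma added_atoms_subset: "added_atoms tree \<subseteq> map_atom_terms hom ` I"
proof
  fix a assume "a \<in> added_atoms tree"
  then obtain R es s ks where a: "a = Atom R es" "tree s = Add R ks" "length es = length ks"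
    "\<forall>i<length ks. es ! i \<in> elements tree s \<and> color tree s (es ! i) = ks ! i"
    unfolding added_atoms_def by blast
  obtain p where p: "(R, ks) \<in> sound_adds p" "content (run start s) = cont p"
    "\<And>x. state_color (run start s) x = enc (pre p x)"
    using sound_adds_tree[OF a(2)] by blast
  define xs where "xs = map (inv_into (cont p) hom) es"
  have *: "hom (xs ! i) = es ! i" "xs ! i \<in> cont p" if "i < length ks" for i
    using that a(3,4) p(2) inv_into_into[of "es ! i" hom "cont p"] f_inv_into_f[of "es ! i" hom "cont p"]
    unfolding xs_def elements_tree by auto
  have "enc (pre p (xs ! i)) = ks ! i" if "i < length ks" for i
    using *[OF that] a(4) that color_tree[of "xs ! i" s] p(2,3) by auto
  then have "Atom R xs \<in> I"
    using p(1) * a(3) unfolding sound_adds_def by (auto simp: xs_def)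
  moreover have "map hom xs = es" using * a(3) by (intro nth_equalityI) (auto simp: xs_def)
  ultimately show "a \<in> map_atom_terms hom ` I" using a(1) by force
qed

text \<open>The last hypothesis says that the color pattern of \<open>xs\<close> at stage
  \<open>p\<close> occurs only at atoms. The addition with this pattern is then in
  \<open>adds p\<close>, and the stage is reached in the tree.\<close>

lemma sound_imp_added:
  assumes "p \<in> insert None (Some ` terms I)" "Atom R xs \<in> I" "set xs \<subseteq> cont p"
    and "\<And>ys. length ys = length xs \<Longrightarrow> set ys \<subseteq> cont p \<Longrightarrow>
      map (pre p) ys = map (pre p) xs \<Longrightarrow> Atom R ys \<in> I"
  shows "Atom R (map hom xs) \<in> added_atoms tree"
proof -
  let ?ks = "map (\<lambda>x. enc (pre p x)) xs"
  have "(R, ?ks) \<in> sound_adds p"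
    unfolding sound_adds_def
  proof (clarsimp, intro conjI allI impI)
    show "R \<in> preds S" "length xs = arity S R" using assms(2) inst unfolding is_instance_def by auto
    show "(\<lambda>x. enc (pre p x)) ` set xs \<subseteq> enc ` colors" using pre_color[OF assms(1)] by auto
    fix ys assume ys: "length ys = length xs \<and>
      (\<forall>i<length xs. ys ! i \<in> cont p \<and> enc (pre p (ys ! i)) = enc (pre p (xs ! i)))"
    then have "map (pre p) ys = map (pre p) xs"
      using pre_color[OF assms(1)] by (intro nth_equalityI) (auto simp: enc_eq_iff)
    then show "Atom R ys \<in> I" using ys by (intro assms(4)) (auto simp: in_set_conv_nth)
  qed
  then obtain as as' where "adds p = as @ (R, ?ks) # as'"
    using set_adds split_list by metis
  then obtain s where s: "run start s = Adds ((R, ?ks) # as') p"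
    using reachable_Adds reachable_adds[OF assms(1)] unfolding reachable_def by metis
  have "hom (xs ! i) \<in> elements tree s \<and> color tree s (hom (xs ! i)) = ?ks ! i"
    if "i < length xs" for i
  proof -
    have "xs ! i \<in> content (run start s)" using that assms(3) s by auto
    then show ?thesis using color_tree that s by (auto simp: elements_tree)
  qed
  moreover have "tree s = Add R ?ks" unfolding tree_def s by simp
  ultimately show ?thesis unfolding added_atoms_def
    by (intro CollectI exI[of _ R] exI[of _ "map hom xs"] exI[of _ s] exI[of _ ?ks]) auto
qed

text \<open>
  The slot of \<open>u\<close> differs from those of all earlier terms linked to terms above \<open>u\<close>, so that the
  color tells the links to \<open>u\<close>.
\<close>

lemma link_iff:
  assumes "u \<in> terms I" "x \<in> above u" "x \<noteq> u"
  shows "(R, d, slot u) \<in> snd (pre (Some u) x) \<longleftrightarrow> Atom R (if d then [x, u] else [u, x]) \<in> I"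
proof
  assume "(R, d, slot u) \<in> snd (pre (Some u) x)"
  then obtain y where y: "y \<in> upto u" "slot u = slot y" "Atom R (if d then [x, y] else [y, x]) \<in> I"
    unfolding pre.simps links_def by auto
  have "y = u" using link_slot[OF assms(1) _ assms(2) y(3)] y(1,2) unfolding upto_def by auto
  then show "Atom R (if d then [x, u] else [u, x]) \<in> I" using y(3) by blast
qed (use assms(3) in \<open>auto simp: links_def upto_def\<close>)

text \<open>At the stage of \<open>u\<close> the flag forces the entry in the place of
  \<open>u\<close> to be \<open>u\<close> itself. The other entry has the color of \<open>x\<close>,
  from which \<open>link_iff\<close> reads off the link to \<open>u\<close>.\<close>

lemma binary_atom_added:
  assumes "u \<in> terms I" "x \<in> above u" "x \<noteq> u" "Atom R (if d then [x, u] else [u, x]) \<in> I"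
  shows "Atom R (map hom (if d then [x, u] else [u, x])) \<in> added_atoms tree"
proof (rule sound_imp_added[of "Some u"])
  fix ys assume ys: "length ys = length (if d then [x, u] else [u, x])" "set ys \<subseteq> cont (Some u)"
    "map (pre (Some u)) ys = map (pre (Some u)) (if d then [x, u] else [u, x])"
  then obtain y z where yz: "ys = (if d then [y, z] else [z, y])"
    by (cases d) (auto simp: length_Suc_conv)
  then have "z = u" "y \<noteq> u" "y \<in> above u" and eq: "pre (Some u) y = pre (Some u) x"
    using ys assms(3) by (auto split: if_splits)
  then show "Atom R ys \<in> I"
    using link_iff[of u y R d] link_iff[of u x R d] assms yz by auto
qed (use assms self_above in auto)

text \<open>A nullary atom is added at the virtual root, a unary atom or a loop at its own term, and
  any other atom at the smaller of its two terms.\<close>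

lemma atom_added:
  assumes "Atom R xs \<in> I"
  shows "Atom R (map hom xs) \<in> added_atoms tree"
proof -
  have "length xs \<le> 2"
    using assms inst bin unfolding is_instance_def binary_signature_def by fastforce
  then consider "xs = []" | x where "xs = [x]" | x y where "xs = [x, y]"
    by (cases xs; cases "tl xs"; cases "tl (tl xs)") auto
  moreover have terms: "set xs \<subseteq> terms I" using assms unfolding terms_def by force
  ultimately show ?thesis
  proof cases
    case 1
    then show ?thesis using sound_imp_added[of None R xs] assms by simp
  next
    case (2 x)
    \<comment> \<open>At the stage of \<open>x\<close> only \<open>x\<close> itself carries the
      flag.\<close>
    have "ys = xs" if "length ys = length xs" "map (pre (Some x)) ys = map (pre (Some x)) xs" for ys
      using that 2 by (cases ys) auto
    then show ?thesis
      using 2 assms terms self_above by (intro sound_imp_added[of "Some x"]) auto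
  next
    case (3 x y)
    then have xy: "x \<in> terms I" "y \<in> terms I" using terms by auto
    have "adjacent I x y" unfolding adjacent_def by (rule bexI[OF _ assms]) (use 3 in auto)
    then consider "x = y" | "x \<noteq> y" "x \<in> above y" | "x \<noteq> y" "y \<in> above x"
      using lt_adjacent xy unfolding above_def by blast
    then show ?thesis
    proof cases
      case 1
      have "ys = xs" if "length ys = length xs" "map (pre (Some x)) ys = map (pre (Some x)) xs" for ys
        using that 3 1 by (auto simp: length_Suc_conv)
      then show ?thesis
        using 3 1 assms terms self_above by (intro sound_imp_added[of "Some x"]) auto
    next
      case 2
      then show ?thesis using binary_atom_added[of y x R True] xy 3 assms by simp
    next
      case 3
      then show ?thesis
        using binary_atom_added[of x y R False] xy \<open>xs = [x, y]\<close> assms by simp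
    qed
  qed
qed

lemma added_atoms_tree: "added_atoms tree = map_atom_terms hom ` I"
proof
  show "map_atom_terms hom ` I \<subseteq> added_atoms tree"
  proof
    fix a assume "a \<in> map_atom_terms hom ` I"
    then obtain R xs where "Atom R xs \<in> I" "a = Atom R (map hom xs)"
      by (metis (no_types) atom.exhaust image_iff map_atom_terms.simps)
    then show "a \<in> added_atoms tree" using atom_added by blast
  qed
qed (rule added_atoms_subset)

lemma represented_tree: "represented S tree = map_atom_terms hom ` top_completion S I"
proof -
  have "top_atoms S (hom ` D) = map_atom_terms hom ` top_atoms S D" for D
    unfolding top_atoms_def by force
  then show ?thesis
    unfolding represented_def top_completion_def added_atoms_tree elements_tree by (simp add: image_Un)
qed

section \<open>Finite cliquewidth\<close>

lemma cliquewidth_finite: "cliquewidth S I < \<infinity>"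
proof -
  let ?Cnst = "{c. Const c \<in> terms I}" and ?col = "\<lambda>t. color tree [] (hom t)"
  let ?J = "top_completion S I"
  have terms_J: "terms ?J = terms I"
    unfolding terms_def top_completion_def top_atoms_def by force
  have "terms (map_atom_terms hom ` ?J) = hom ` terms ?J"
  proof -
    have "set (args (map_atom_terms hom a)) = hom ` set (args a)" for a :: "('p, 'c, 'n) atom"
      by (cases a) simp
    then show ?thesis unfolding terms_def by auto
  qed
  then have "bij_betw hom (terms I) (terms (represented S tree))"
    using inj_hom unfolding represented_tree terms_J bij_betw_def by blast
  moreover have "t = Const c \<longleftrightarrow> hom t = Const c" for t c by (cases t) (auto simp: hom_def)
  ultimately have "colored_isomorphism hom (?J, ?col) (represented S tree, color tree [])"
    unfolding colored_isomorphism_def by (simp add: represented_tree terms_J)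
  moreover have "?col ` terms I \<subseteq> enc ` colors"
    using color_tree[of _ "[]"] pre_color[of None] by auto
  moreover have "finite ?Cnst" using inst unfolding is_instance_def by blast
  ultimately have "cliquewidth S I \<le> enat (card (enc ` colors))"
    unfolding cliquewidth_def using well_decorated_tree finite_colors
    by (intro Inf_lower CollectI exI[of _ "enc ` colors"]) blast
  then show ?thesis using enat_ord_simps(4) le_less_trans by blast
qed

end

theorem theorem14:
  fixes S :: "'p sgn" and I :: "('p, 'c, 'n) atom set"
  assumes "signature S"
    and "binary_signature S"
    and "is_instance S I"
    and "treewidth TYPE('v) I < \<infinity>"
  shows "cliquewidth S I < \<infinity>"
proof -
  have "\<exists>(V :: 'v set) E bag. tree_decomposition I V E bag \<and> width V bag < \<infinity>"
    using assms(4) unfolding treewidth_def Inf_less_iff by blast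
  then obtain V :: "'v set" and E bag where
    td: "tree_decomposition I V E bag" and w: "width V bag < \<infinity>" by blast
  \<comment> \<open>Since \<open>\<infinity> - 1 = \<infinity>\<close>, a finite width forces a
    finite supremum \<open>k\<close> of the bag sizes.\<close>
  have "(SUP v\<in>V. ecard (bag v)) \<noteq> \<infinity>" using w unfolding width_def
    by (metis idiff_infinity less_irrefl)
  then obtain k where k: "(SUP v\<in>V. ecard (bag v)) = enat k" by auto
  have bags: "finite (bag v) \<and> card (bag v) \<le> k" if "v \<in> V" for v
  proof -
    have "ecard (bag v) \<le> enat k" unfolding k[symmetric] using that by (rule SUP_upper)
    then show ?thesis unfolding ecard_def by (auto split: if_splits)
  qed
  have "countable (terms I)"
    using assms(3) unfolding terms_def is_instance_def by (auto intro: countable_finite)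
  then obtain code :: "('c, 'n) trm \<Rightarrow> nat" where code: "inj_on code (terms I)"
    unfolding countable_def by blast
  obtain lt where lt: "elimination_order I lt"
    "\<And>u. u \<in> terms I \<Longrightarrow> card (elimination_order.separator I lt u) \<le> k"
    using tree_decomposition_imp_elimination_order[OF td bags code] by blast
  interpret elimination_order I lt by (rule lt(1))
  obtain slot :: "('c, 'n) trm \<Rightarrow> nat"
    where "\<forall>u\<in>terms I. slot u \<le> k \<and> slot u \<notin> slot ` separator u"
    using exists_slots[OF lt(2)] by blast
  then have "slotted_elimination_order I lt S slot k code"
    by unfold_locales (use assms code in auto)
  then show ?thesis by (rule slotted_elimination_order.cliquewidth_finite)
qed

end
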